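(* The real vector space $\mathrm{GA}(\infty,\infty)$, with the multiplication defined in the context, is an associative algebra over the field $\mathbb{R}$ of real numbers, having $\mathbf{1}$ as a two-sided unit. It is generated as an algebra by the elements $\mathbf{e}_i$ ($i \in \mathbb{Z}$), which are linearly independent over $\mathbb{R}$ and satisfy, for all $i, j \in \mathbb{Z}$: \[ \mathbf{e}_i^2 = \mathbf{1} \ \text{ if } i \ge 0, \qquad \mathbf{e}_i^2 = -\mathbf{1} \ \text{ if } i < 0, \qquad \mathbf{e}_i\mathbf{e}_j = -\mathbf{e}_j\mathbf{e}_i \ \text{ if } i \neq j. \]
   Context: Let $\mathbb{F}\mathbb{Z}$ denote the set of all finite sets of integers, $\# A$ the number of elements of a finite set $A$, and $A \ominus B = (A \setminus B) \cup (B \setminus A)$ the symmetric difference of sets $A$ and $B$. The natural numbers $\mathbb{N}$ include $0$. Define functions $\alpha, \beta : \mathbb{F}\mathbb{Z} \times \mathbb{F}\mathbb{Z} \to \mathbb{N}$ and $\sigma : \mathbb{F}\mathbb{Z} \times \mathbb{F}\mathbb{Z} \to \{+1,-1\}$ by \[ \alpha(I,J) = \#\{(i,j) \mid i \in I,\ j \in J,\ j < i\}, \] \[ \beta(I,J) = \#\{i \mid i \in I,\ i \in J,\ i < 0\}, \] \[ \sigma(I,J) = (-1)^{\alpha(I,J)+\beta(I,J)}. \] $\mathrm{GA}(\infty,\infty)$ is the real vector space with a basis of symbols $\mathbf{e}_I$, one for each $I \in \mathbb{F}\mathbb{Z}$; so each element is uniquely a sum $\sum_{I \in \mathbb{F}\mathbb{Z}}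 \lambda_I \mathbf{e}_I$ with real coefficients $\lambda_I$, all but finitely many of which are $0$. Its multiplication is defined by \[ \Bigl(\sum_I \lambda_I \mathbf{e}_I\Bigr)\Bigl(\sum_J \mu_J \mathbf{e}_J\Bigr) = \sum_{I,J} \lambda_I \mu_J\, \sigma(I,J)\, \mathbf{e}_{I \ominus J}. \] Put $\mathbf{1} = \mathbf{e}_{\emptyset}$ and $\mathbf{e}_i = \mathbf{e}_{\{i\}}$ for each $i \in \mathbb{Z}$. An algebra over $\mathbb{R}$ is a real vector space with a multiplication satisfying $(\lambda \mathbf{x})(\mu \mathbf{y}) = (\lambda\mu)(\mathbf{x}\mathbf{y})$, $(\mathbf{x}+\mathbf{y})\mathbf{z} = \mathbf{x}\mathbf{z}+\mathbf{y}\mathbf{z}$ and $\mathbf{x}(\mathbf{y}+\mathbf{z}) = \mathbf{x}\mathbf{y}+\mathbf{x}\mathbf{z}$ for all scalars $\lambda,\mu \in \mathbb{R}$ and all elements $\mathbf{x},\mathbf{y},\mathbf{z}$. *)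

theory Defs
  imports "HOL-Library.FSet" "HOL-Analysis.Finite_Function_Topology"
begin

definition alpha :: "int fset \<Rightarrow> int fset \<Rightarrow> nat" where
  "alpha I J = card {(i, j). i |\<in>| I \<and> j |\<in>| J \<and> j < i}"

definition beta :: "int fset \<Rightarrow> int fset \<Rightarrow> nat" where
  "beta I J = card {i. i |\<in>| I \<and> i |\<in>| J \<and> i < 0}"

definition sigma :: "int fset \<Rightarrow> int fset \<Rightarrow> real" where
  "sigma I J = (- 1) ^ (alpha I J + beta I J)"

definition fsym_diff :: "int fset \<Rightarrow> int fset \<Rightarrow> int fset" (infixl "\<ominus>" 65) where
  "I \<ominus> J = (I |-| J) |\<union>| (J |-| I)"

(* The coefficient of the basis symbol indexed by I in x is lookup x I. *)
type_synonym ga = "int fset \<Rightarrow>\<^sub>0 real"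

definition eb :: "int fset \<Rightarrow> ga" where
  "eb I = Poly_Mapping.single I 1"

lemma lookup_scaleR_ga:
  fixes x :: ga
  shows "Poly_Mapping.lookup (r *\<^sub>R x) I = r * Poly_Mapping.lookup x I"
proof -
  have "finite {k. r *\<^sub>R Poly_Mapping.lookup x k \<noteq> 0}"
    by (rule finite_subset[OF _ finite_keys[of x]]) (auto simp: in_keys_iff)
  then show ?thesis
    by (simp add: scaleR_poly_mapping_def lookup_Abs_poly_mapping)
qed

lemma ga_expansion:
  fixes x :: ga
  shows "x = (\<Sum>I\<in>Poly_Mapping.keys x. Poly_Mapping.lookup x I *\<^sub>R eb I)"
proof (rule poly_mapping_eqI)
  fix K
  have "Poly_Mapping.lookup (\<Sum>I\<in>Poly_Mapping.keys x. Poly_Mapping.lookup x I *\<^sub>R eb I) K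
      = (\<Sum>I\<in>Poly_Mapping.keys x. if I = K then Poly_Mapping.lookup x I else 0)"
    unfolding lookup_sum
    by (intro sum.cong refl) (simp add: eb_def lookup_scaleR_ga lookup_single when_def)
  then show "Poly_Mapping.lookup x K =
      Poly_Mapping.lookup (\<Sum>I\<in>Poly_Mapping.keys x. Poly_Mapping.lookup x I *\<^sub>R eb I) K"
    by (simp add: in_keys_iff)
qed

(* The type class product on poly_mapping is a convolution over a monoid of keys and
   is not the product meant here. *)
definition ga_mult :: "ga \<Rightarrow> ga \<Rightarrow> ga" (infixl "\<odot>" 70) where
  "x \<odot> y = (\<Sum>I\<in>Poly_Mapping.keys x. \<Sum>J\<in>Poly_Mapping.keys y.
     (Poly_Mapping.lookup x I * Poly_Mapping.lookup y J * sigma I J) *\<^sub>R eb (I \<ominus> J))"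

definition ga_one :: ga where
  "ga_one = eb {||}"

definition gen :: "int \<Rightarrow> ga" where
  "gen i = eb {|i|}"

definition real_algebra_mult :: "('a::real_vector \<Rightarrow> 'a \<Rightarrow> 'a) \<Rightarrow> bool" where
  "real_algebra_mult m \<longleftrightarrow>
     (\<forall>r s x y. m (r *\<^sub>R x) (s *\<^sub>R y) = (r * s) *\<^sub>R m x y) \<and>
     (\<forall>x y z. m (x + y) z = m x z + m y z) \<and>
     (\<forall>x y z. m x (y + z) = m x y + m x z)"

(* Subalgebras are not required to contain a unit, so generation as an algebra does not
   presuppose one. *)
definition is_subalgebra :: "('a::real_vector \<Rightarrow> 'a \<Rightarrow> 'a) \<Rightarrow> 'a set \<Rightarrow> bool" where
  "is_subalgebra m S \<longleftrightarrow> subspace S \<and> (\<forall>x\<in>S. \<forall>y\<in>S. m x y \<in> S)"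

end

theory Submission
  imports Defs
begin

text \<open>
  The sign \<open>\<sigma>\<close> is multiplicative in each argument with respect to symmetric difference, because
  \<open>\<alpha>\<close> and \<open>\<beta>\<close> count sets which depend on each argument by intersection and product, and
  cardinality modulo 2 is additive on symmetric differences. Hence both ways of bracketing a product
  of three basis elements carry the sign \<open>\<sigma>(I,J) \<sigma>(I,K) \<sigma>(J,K)\<close>, and associativity follows
  by multilinearity.
\<close>

subsection \<open>The sign\<close>

text \<open>\<open>card A + card B\<close> counts each common element twice and every other element
  once, so it has the same parity as the cardinality of the symmetric difference.\<close>

lemma minus_one_power_card_symdiff:
  assumes "finite A" "finite B"
  shows "(- 1 :: 'a::comm_ring_1) ^ card ((A - B) \<union> (B - A)) = (- 1) ^ card A * (- 1) ^ card B"
proof -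
  have "card ((A - B) \<union> (B - A)) + 2 * card (A \<inter> B) = card A + card B"
    using card_Un_disjoint[of "A - B" "B - A"] card_Int_Diff[of A B] card_Int_Diff[of B A] assms
    by (auto simp: Int_commute)
  then have "(- 1 :: 'a) ^ (card ((A - B) \<union> (B - A)) + 2 * card (A \<inter> B)) = (- 1) ^ (card A + card B)"
    by simp
  then show ?thesis
    by (simp add: power_add power_mult)
qed

lemma fmember_fsym_diff: "i |\<in>| I \<ominus> J \<longleftrightarrow> (i |\<in>| I) \<noteq> (i |\<in>| J)"
  by (auto simp: fsym_diff_def)

lemma fsym_diff_assoc: "(I \<ominus> J) \<ominus> K = I \<ominus> (J \<ominus> K)"
  by (rule fset_eqI) (auto simp: fmember_fsym_diff)

lemma fsym_diff_commute: "I \<ominus> J = J \<ominus> I"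
  by (rule fset_eqI) (auto simp: fmember_fsym_diff)

lemma fsym_diff_self [simp]: "I \<ominus> I = {||}"
  by (rule fset_eqI) (auto simp: fmember_fsym_diff)

lemma fsym_diff_fempty [simp]: "I \<ominus> {||} = I" "{||} \<ominus> I = I"
  by (auto simp: fsym_diff_def)

lemma finite_alpha_set: "finite {(i, j). i |\<in>| I \<and> j |\<in>| J \<and> j < i}"
  for I J :: "int fset"
  by (rule finite_subset[of _ "fset I \<times> fset J"]) auto

lemma finite_beta_set: "finite {i. i |\<in>| I \<and> i |\<in>| J \<and> i < 0}"
  for I J :: "int fset"
  by (rule finite_subset[of _ "fset I"]) auto

lemma sigma_fsym_diff_left: "sigma (I \<ominus> J) K = sigma I K * sigma J K"
proof -
  let ?A = "\<lambda>I. {(i, j). i |\<in>| I \<and> j |\<in>| K \<and> j < i}"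
  let ?B = "\<lambda>I. {i. i |\<in>| I \<and> i |\<in>| K \<and> i < 0}"
  have "?A (I \<ominus> J) = (?A I - ?A J) \<union> (?A J - ?A I)" "?B (I \<ominus> J) = (?B I - ?B J) \<union> (?B J - ?B I)"
    by (auto simp: fmember_fsym_diff)
  then show ?thesis
    by (simp add: sigma_def alpha_def beta_def power_add
        minus_one_power_card_symdiff[OF finite_alpha_set finite_alpha_set]
        minus_one_power_card_symdiff[OF finite_beta_set finite_beta_set])
qed

lemma sigma_fsym_diff_right: "sigma K (I \<ominus> J) = sigma K I * sigma K J"
proof -
  let ?A = "\<lambda>I. {(i, j). i |\<in>| K \<and> j |\<in>| I \<and> j < i}"
  let ?B = "\<lambda>I. {i. i |\<in>| K \<and> i |\<in>| I \<and> i < 0}"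
  have "?A (I \<ominus> J) = (?A I - ?A J) \<union> (?A J - ?A I)" "?B (I \<ominus> J) = (?B I - ?B J) \<union> (?B J - ?B I)"
    by (auto simp: fmember_fsym_diff)
  then show ?thesis
    by (simp add: sigma_def alpha_def beta_def power_add
        minus_one_power_card_symdiff[OF finite_alpha_set finite_alpha_set]
        minus_one_power_card_symdiff[OF finite_beta_set finite_beta_set])
qed

lemma sigma_fempty [simp]: "sigma {||} I = 1" "sigma I {||} = 1"
  by (simp_all add: sigma_def alpha_def beta_def)

text \<open>The first factor comes from \<open>alpha\<close> and yields anticommutation; the second
  comes from \<open>beta\<close> and yields the squares of the generators.\<close>

lemma sigma_singletons:
  "sigma {|i|} {|j|} = (if j < i then - 1 else 1) * (if i = j \<and> i < 0 then - 1 else 1)"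
proof -
  have "{(a, b). a |\<in>| {|i|} \<and> b |\<in>| {|j|} \<and> b < a} = (if j < i then {(i, j)} else {})"
    "{a. a |\<in>| {|i|} \<and> a |\<in>| {|j|} \<and> a < 0} = (if i = j \<and> i < 0 then {i} else {})"
    by auto
  then show ?thesis
    by (simp add: sigma_def alpha_def beta_def)
qed

lemma sigma_mult_self: "sigma I J * sigma I J = 1"
  by (simp add: sigma_def flip: power_mult_distrib)

subsection \<open>The product\<close>

text \<open>The extra terms have coefficient zero. Larger index sets let products be compared over
  common ones, although cancellation in a sum or scaling by 0 may shrink the set of keys.\<close>

lemma ga_mult_superset:
  assumes "finite A" "Poly_Mapping.keys x \<subseteq> A" "finite B" "Poly_Mapping.keys y \<subseteq> B"
  shows "x \<odot> y = (\<Sum>I\<in>A. \<Sum>J\<in>B.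
    (Poly_Mapping.lookup x I * Poly_Mapping.lookup y J * sigma I J) *\<^sub>R eb (I \<ominus> J))"
  unfolding ga_mult_def
proof (rule sum.mono_neutral_cong_left)
  fix I assume "I \<in> Poly_Mapping.keys x"
  show "(\<Sum>J\<in>Poly_Mapping.keys y.
      (Poly_Mapping.lookup x I * Poly_Mapping.lookup y J * sigma I J) *\<^sub>R eb (I \<ominus> J)) =
    (\<Sum>J\<in>B. (Poly_Mapping.lookup x I * Poly_Mapping.lookup y J * sigma I J) *\<^sub>R eb (I \<ominus> J))"
    by (rule sum.mono_neutral_left) (use assms in \<open>auto simp: in_keys_iff\<close>)
qed (use assms in \<open>auto simp: in_keys_iff\<close>)

lemma ga_mult_add_left: "(x + y) \<odot> z = x \<odot> z + y \<odot> z"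
proof -
  let ?A = "Poly_Mapping.keys x \<union> Poly_Mapping.keys y"
  have "Poly_Mapping.keys (x + y) \<subseteq> ?A"
    by (rule Poly_Mapping.keys_add)
  then show ?thesis
    by (simp add: ga_mult_superset[of ?A _ "Poly_Mapping.keys z"] lookup_add distrib_right
        scaleR_add_left sum.distrib)
qed

lemma ga_mult_add_right: "x \<odot> (y + z) = x \<odot> y + x \<odot> z"
proof -
  let ?B = "Poly_Mapping.keys y \<union> Poly_Mapping.keys z"
  have "Poly_Mapping.keys (y + z) \<subseteq> ?B"
    by (rule Poly_Mapping.keys_add)
  then show ?thesis
    by (simp add: ga_mult_superset[of "Poly_Mapping.keys x" _ ?B] lookup_add distrib_left
        distrib_right scaleR_add_left sum.distrib)
qed

lemma keys_scaleR_ga: "Poly_Mapping.keys (r *\<^sub>R x) \<subseteq> Poly_Mapping.keys x" for x :: ga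
  by (auto simp: in_keys_iff lookup_scaleR_ga)

lemma ga_mult_scaleR_scaleR: "(r *\<^sub>R x) \<odot> (s *\<^sub>R y) = (r * s) *\<^sub>R (x \<odot> y)"
  by (simp add: ga_mult_superset[of "Poly_Mapping.keys x" _ "Poly_Mapping.keys y"]
      keys_scaleR_ga lookup_scaleR_ga scaleR_sum_right mult_ac)

lemma ga_mult_scaleR_left: "(r *\<^sub>R x) \<odot> y = r *\<^sub>R (x \<odot> y)"
  using ga_mult_scaleR_scaleR[of r x 1 y] by simp

lemma ga_mult_scaleR_right: "x \<odot> (r *\<^sub>R y) = r *\<^sub>R (x \<odot> y)"
  using ga_mult_scaleR_scaleR[of 1 x r y] by simp

lemma eb_mult_eb: "eb I \<odot> eb J = sigma I J *\<^sub>R eb (I \<ominus> J)"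
  by (simp add: ga_mult_def eb_def)

text \<open>By \<open>ga_expansion\<close> the elements \<open>eb I\<close> span the space, so a
  linear map is determined by its values on them.\<close>

lemma ga_linear_eqI:
  fixes f g :: "ga \<Rightarrow> 'a::real_vector"
  assumes "linear f" "linear g" "\<And>I. f (eb I) = g (eb I)"
  shows "f x = g x"
  by (subst (1 2) ga_expansion[of x])
    (simp add: linear_sum[OF assms(1)] linear_sum[OF assms(2)]
      linear_scale[OF assms(1)] linear_scale[OF assms(2)] assms(3))

lemma linear_ga_mult: "linear (\<lambda>x. x \<odot> y)" "linear (\<lambda>y. x \<odot> y)"
  by (auto intro!: linearI
      simp: ga_mult_add_left ga_mult_add_right ga_mult_scaleR_left ga_mult_scaleR_right)

lemma eb_mult_assoc: "(eb I \<odot> eb J) \<odot> eb K = eb I \<odot> (eb J \<odot> eb K)"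
  by (simp add: eb_mult_eb ga_mult_scaleR_left ga_mult_scaleR_right sigma_fsym_diff_left
      sigma_fsym_diff_right fsym_diff_assoc mult_ac)

lemma ga_mult_assoc: "(x \<odot> y) \<odot> z = x \<odot> (y \<odot> z)"
proof -
  \<comment> \<open>The compositions make both bracketings linear in each variable separately.
    Starting from \<open>eb_mult_assoc\<close>, the basis elements are then replaced by arbitrary
    ones in the order \<open>z\<close>, \<open>y\<close>, \<open>x\<close>.\<close>
  note lin = linear_ga_mult linear_compose[OF linear_ga_mult(1) linear_ga_mult(1), unfolded o_def]
    linear_compose[OF linear_ga_mult(1) linear_ga_mult(2), unfolded o_def]
    linear_compose[OF linear_ga_mult(2) linear_ga_mult(2), unfolded o_def]
    linear_compose[OF linear_ga_mult(2) linear_ga_mult(1), unfolded o_def]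
  have 1: "(eb I \<odot> eb J) \<odot> z = eb I \<odot> (eb J \<odot> z)" for I J
    by (rule ga_linear_eqI[of "\<lambda>z. (eb I \<odot> eb J) \<odot> z" "\<lambda>z. eb I \<odot> (eb J \<odot> z)"])
      (intro lin eb_mult_assoc)+
  have 2: "(eb I \<odot> y) \<odot> z = eb I \<odot> (y \<odot> z)" for I
    by (rule ga_linear_eqI[of "\<lambda>y. (eb I \<odot> y) \<odot> z" "\<lambda>y. eb I \<odot> (y \<odot> z)"])
      (intro lin 1)+
  show ?thesis
    by (rule ga_linear_eqI[of "\<lambda>x. (x \<odot> y) \<odot> z" "\<lambda>x. x \<odot> (y \<odot> z)"])
      (intro lin 2)+
qed

lemma ga_one_mult: "ga_one \<odot> x = x"
  by (rule ga_linear_eqI[of "\<lambda>x. ga_one \<odot> x" "\<lambda>x. x"])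
    (simp_all add: linear_ga_mult linear_ident ga_one_def eb_mult_eb)

lemma mult_ga_one: "x \<odot> ga_one = x"
  by (rule ga_linear_eqI[of "\<lambda>x. x \<odot> ga_one" "\<lambda>x. x"])
    (simp_all add: linear_ga_mult linear_ident ga_one_def eb_mult_eb)

subsection \<open>The generators\<close>

lemma gen_mult_self: "gen i \<odot> gen i = (if i < 0 then - ga_one else ga_one)"
  by (simp add: gen_def eb_mult_eb sigma_singletons ga_one_def)

text \<open>Exactly one of \<open>j < i\<close> and \<open>i < j\<close> holds, so exactly one of
  the two products picks up a sign from \<open>alpha\<close>, while \<open>beta\<close> contributes
  none.\<close>

lemma gen_mult_anticommute:
  assumes "i \<noteq> j"
  shows "gen i \<odot> gen j = - (gen j \<odot> gen i)"
  using assms by (auto simp: gen_def eb_mult_eb sigma_singletons fsym_diff_commute[of "{|i|}"])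

text \<open>A sign is its own inverse, so the sign in \<open>eb_mult_eb\<close> can be moved to the
  other side. This is the induction step for writing basis elements as signed products of
  generators.\<close>

lemma eb_finsert:
  assumes "i |\<notin>| I"
  shows "eb (finsert i I) = sigma {|i|} I *\<^sub>R (gen i \<odot> eb I)"
proof -
  have "{|i|} \<ominus> I = finsert i I"
    using assms by (auto simp: fsym_diff_def)
  then show ?thesis
    by (simp add: gen_def eb_mult_eb sigma_mult_self)
qed

lemma subalgebra_gen_eq_UNIV:
  assumes S: "is_subalgebra (\<odot>) S" and gen: "range gen \<subseteq> S"
  shows "S = UNIV"
proof -
  have sub: "subspace S" and mult: "\<And>x y. x \<in> S \<Longrightarrow> y \<in> S \<Longrightarrow> x \<odot> y \<in> S"
    using S by (auto simp: is_subalgebra_def)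
  have eb: "eb I \<in> S" for I
  proof (induction I)
    case empty
    \<comment> \<open>A subalgebra is not assumed to contain the unit, so the unit is obtained as
      the square of a generator; any nonnegative index would serve.\<close>
    have "eb {||} = gen 0 \<odot> gen 0"
      by (simp add: gen_mult_self ga_one_def)
    then show ?case
      using gen by (auto intro: mult)
  next
    case (insert i I)
    then show ?case
      using gen by (auto simp: eb_finsert intro!: subspace_scale[OF sub] mult)
  qed
  have "x \<in> S" for x
    by (subst ga_expansion) (intro subspace_sum[OF sub] subspace_scale[OF sub] eb)
  then show ?thesis
    by blast
qed

text \<open>The coefficient at \<open>{|j|}\<close> acts as a dual functional to
  \<open>gen j\<close>; both injectivity and independence of the generators rest on it.\<close>

lemma lookup_gen: "Poly_Mapping.lookup (gen i) {|j|} = (if i = j then 1 else 0)"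
  by (simp add: gen_def eb_def lookup_single when_def)

lemma inj_gen: "inj gen"
  by (rule injI) (metis lookup_gen zero_neq_one)

lemma independent_range_gen: "independent (range gen)"
proof -
  have "u (gen i) = 0"
    if "finite t" "t \<subseteq> range gen" "(\<Sum>v\<in>t. u v *\<^sub>R v) = 0" "gen i \<in> t" for t u i
  proof -
    \<comment> \<open>Reading off the coefficient at \<open>{|i|}\<close> in the vanishing
      combination isolates \<open>u (gen i)\<close>.\<close>
    have "0 = Poly_Mapping.lookup (\<Sum>v\<in>t. u v *\<^sub>R v) {|i|}"
      by (simp add: that(3))
    also have "\<dots> = (\<Sum>v\<in>t. if v = gen i then u v else 0)"
      unfolding lookup_sum
    proof (rule sum.cong)
      fix v assume "v \<in> t"
      then obtain j where "v = gen j"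
        using \<open>t \<subseteq> range gen\<close> by blast
      then show "Poly_Mapping.lookup (u v *\<^sub>R v) {|i|} = (if v = gen i then u v else 0)"
        by (simp add: lookup_scaleR_ga lookup_gen inj_eq[OF inj_gen])
    qed simp
    also have "\<dots> = u (gen i)"
      using that by simp
    finally show ?thesis
      by simp
  qed
  then show ?thesis
    unfolding dependent_explicit by blast
qed

text \<open>Independence of the set \<open>range gen\<close> does not see repetitions, so
  independence of the family is expressed by adding \<open>inj gen\<close>.\<close>

theorem theorem1:
  shows "real_algebra_mult (\<odot>)
    \<and> (\<forall>x y z. (x \<odot> y) \<odot> z = x \<odot> (y \<odot> z))
    \<and> (\<forall>x. ga_one \<odot> x = x \<and> x \<odot> ga_one = x)
    \<and> is_subalgebra (\<odot>) hull (range gen) = UNIV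
    \<and> inj gen \<and> independent (range gen)
    \<and> (\<forall>i. i \<ge> 0 \<longrightarrow> gen i \<odot> gen i = ga_one)
    \<and> (\<forall>i. i < 0 \<longrightarrow> gen i \<odot> gen i = - ga_one)
    \<and> (\<forall>i j. i \<noteq> j \<longrightarrow> gen i \<odot> gen j = - (gen j \<odot> gen i))"
proof (intro conjI allI impI)
  show "real_algebra_mult (\<odot>)"
    by (simp add: real_algebra_mult_def ga_mult_scaleR_scaleR ga_mult_add_left ga_mult_add_right)
  \<comment> \<open>The hull is the intersection of all subalgebras containing the generators, and
    each of these is the whole space.\<close>
  show "is_subalgebra (\<odot>) hull (range gen) = UNIV"
    by (auto simp: hull_def dest: subalgebra_gen_eq_UNIV)
qed (simp_all add: ga_mult_assoc ga_one_mult mult_ga_one inj_gen independent_range_gen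
      gen_mult_self, rule gen_mult_anticommute)

end
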